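(* Let $L$ be a complete, meet-continuous modular lattice and $x\prec y$ a covering in $L$. If $\upsilon[x\prec y]$ (computed in $L$) is infinite, then $\lambda[\mathrm{Fg}\{x\}\prec\mathrm{Fg}\{y\}]$ (computed in $\mathrm{Fil}\,L$) is infinite.
   Context: A covering $x\prec y$ in a lattice is a pair $x<y$ with no element strictly between. For pairs with $x\le y$, $z\le w$, write $\langle x,y\rangle\nearrow\langle z,w\rangle$ if $y\wedge z=x$ and $y\vee z=w$; projective equivalence $\sim$ is the symmetric and transitive closure of $\nearrow$. A complete lattice $L$ is meet-continuous if $a\wedge\bigvee D=\bigvee_{d\in D}(a\wedge d)$ for all $a\in L$ and all upward directed $D\subseteq L$. For a chain $C$ in a modular lattice $M$ and a covering $x\prec y$ of $M$, $\mu_C[x\prec y]$ is the cardinality of the set of coverings $u\prec v$ of $M$ with $u,v\in C$ and $\langle u,v\rangle\sim\langle x,y\rangle$. The multiplicity upper bound $\upsilon[x\prec y]$ in $M$ is the least cardinal $\nu$ such that $\mu_C[x\prec y]<\nu$ for every chain $C$ in $M$. The multiplicity lower bound $\lambda[x\prec y]$ in $M$ is the least cardinal $\nu$ such that $\mu_C[x\prec y]=\nu$ for some maximal chain $C$ in $M$. A filter of $L$ is a nonempty up-closed subset closed under binary meets. $\mathrm{Fil}\,L$ is the lattice of filters ordered by reverse inclusion ($F\le G$ iff $G\subseteq F$); it is complete and modular when $L$ is. $\mathrm{Fg}\{x\}=\{z\in L: z\ge x\}$; for $L$ modular, $x\prec y$ implies $\mathrm{Fg}\{x\}\prec\mathrm{Fg}\{y\}$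 in $\mathrm{Fil}\,L$. *)

theory Defs
  imports Main
begin

unbundle cardinal_syntax

class modular_lattice = lattice +
  assumes modular: "a \<le> c \<Longrightarrow> sup a (inf b c) = inf (sup a b) c"

class meet_continuous_lattice = complete_lattice +
  assumes meet_continuous:
    "D \<noteq> {} \<Longrightarrow> (\<And>d e. d \<in> D \<Longrightarrow> e \<in> D \<Longrightarrow> \<exists>f\<in>D. d \<le> f \<and> e \<le> f) \<Longrightarrow>
      inf a (Sup D) = Sup ((\<lambda>d. inf a d) ` D)"

definition covers :: "'a::order \<Rightarrow> 'a \<Rightarrow> bool"  (infix \<open>\<prec>\<close> 50)
  where "x \<prec> y \<longleftrightarrow> x < y \<and> \<not> (\<exists>z. x < z \<and> z < y)"

definition persp_up :: "'a::lattice \<times> 'a \<Rightarrow> 'a \<times> 'a \<Rightarrow> bool"  (infix \<open>\<nearrow>\<close> 50)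
  where "p \<nearrow> q \<longleftrightarrow> fst p \<le> snd p \<and> fst q \<le> snd q \<and>
    inf (snd p) (fst q) = fst p \<and> sup (snd p) (fst q) = snd q"

definition projective :: "'a::lattice \<times> 'a \<Rightarrow> 'a \<times> 'a \<Rightarrow> bool"
  where "projective = (symclp persp_up)\<^sup>+\<^sup>+"

definition coverings_in :: "'a::lattice set \<Rightarrow> 'a \<Rightarrow> 'a \<Rightarrow> ('a \<times> 'a) set"
  where "coverings_in C x y = {(u, v). u \<in> C \<and> v \<in> C \<and> u \<prec> v \<and> projective (u, v) (x, y)}"

text \<open>Cardinals are well-order relations, determined only up to \<open>=o\<close>.  The least cardinal
  with a property is therefore a chosen representative.\<close>

definition least_card :: "('c rel \<Rightarrow> bool) \<Rightarrow> 'c rel"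
  where "least_card P = (SOME \<nu>. Card_order \<nu> \<and> P \<nu> \<and> (\<forall>\<nu>'. Card_order \<nu>' \<and> P \<nu>' \<longrightarrow> \<nu> \<le>o \<nu>'))"

text \<open>The upper bound may have to exceed the number of all pairs of elements, but never exceeds
  the successor of that number. So relations on \<open>('a \<times> 'a) set\<close> suffice to represent it,
  whereas the lower bound is the cardinality of a set of pairs.\<close>

definition mult_upper :: "'a::lattice \<Rightarrow> 'a \<Rightarrow> ('a \<times> 'a) set rel"
  where "mult_upper x y =
    least_card (\<lambda>\<nu>. \<forall>C. pred_on.chain UNIV (<) C \<longrightarrow> |coverings_in C x y| <o \<nu>)"

definition mult_lower :: "'a::lattice \<Rightarrow> 'a \<Rightarrow> ('a \<times> 'a) rel"
  where "mult_lower x y =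
    least_card (\<lambda>\<nu>. \<exists>C. pred_on.maxchain UNIV (<) C \<and> |coverings_in C x y| =o \<nu>)"

text \<open>Both minima are attained, so the choice in \<^const>\<open>least_card\<close> is never vacuous; and in
  \<open>mult_upper_props\<close> the cardinal \<open>\<nu>\<close> may live on any type, so minimality is absolute.\<close>

lemma least_card_props:
  assumes "Card_order \<kappa>" "P \<kappa>"
  shows "Card_order (least_card P)" "P (least_card P)"
    "Card_order \<nu> \<Longrightarrow> P \<nu> \<Longrightarrow> least_card P \<le>o \<nu>"
proof -
  have "\<exists>r\<in>{r. Card_order r \<and> P r}. \<forall>r'\<in>{r. Card_order r \<and> P r}. r \<le>o r'"
    by (rule exists_minim_Card_order) (use assms in auto)
  then have "\<exists>\<nu>. Card_order \<nu> \<and> P \<nu> \<and> (\<forall>\<nu>'. Card_order \<nu>' \<and> P \<nu>' \<longrightarrow> \<nu> \<le>o \<nu>')"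
    by auto
  from someI_ex[OF this] show "Card_order (least_card P)" "P (least_card P)"
    "Card_order \<nu> \<Longrightarrow> P \<nu> \<Longrightarrow> least_card P \<le>o \<nu>"
    unfolding least_card_def by auto
qed

lemma mult_upper_props:
  fixes x y :: "'a::lattice"
  shows "Card_order (mult_upper x y)"
    "pred_on.chain UNIV (<) C \<Longrightarrow> |coverings_in C x y| <o mult_upper x y"
    "Card_order \<nu> \<Longrightarrow> (\<And>C. pred_on.chain UNIV (<) C \<Longrightarrow> |coverings_in C x y| <o \<nu>) \<Longrightarrow>
      mult_upper x y \<le>o \<nu>"
proof -
  let ?P = "\<lambda>\<nu>::('a \<times> 'a) set rel. \<forall>C. pred_on.chain UNIV (<) C \<longrightarrow> |coverings_in C x y| <o \<nu>"
  let ?\<kappa> = "cardSuc |UNIV :: ('a \<times> 'a) set|"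
  have "|coverings_in C x y| <o ?\<kappa>" for C
    by (rule ordLeq_ordLess_trans[OF card_of_mono1[OF subset_UNIV] cardSuc_greater])
      (rule card_of_Card_order)
  then have "Card_order ?\<kappa>" "?P ?\<kappa>"
    by (auto intro: cardSuc_Card_order card_of_Card_order)
  note least = least_card_props[of ?\<kappa> ?P, OF this]
  show upper: "Card_order (mult_upper x y)"
    unfolding mult_upper_def by (rule least(1))
  show "|coverings_in C x y| <o mult_upper x y" if "pred_on.chain UNIV (<) C"
    unfolding mult_upper_def by (rule mp[OF spec[OF least(2)] that])
  show "mult_upper x y \<le>o \<nu>"
    if \<nu>: "Card_order \<nu>" "\<And>C. pred_on.chain UNIV (<) C \<Longrightarrow> |coverings_in C x y| <o \<nu>"
  proof (rule ccontr)
    assume "\<not> mult_upper x y \<le>o \<nu>"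
    then have less: "\<nu> <o mult_upper x y"
      using not_ordLeq_iff_ordLess[OF card_order_on_well_order_on[OF \<nu>(1)]
          card_order_on_well_order_on[OF upper]] by (rule rev_iffD1)
    have iso: "|Field \<nu>| =o \<nu>"
      by (rule card_of_Field_ordIso[OF \<nu>(1)])
    then have "|Field \<nu>| \<le>o mult_upper x y"
      by (rule ordIso_ordLeq_trans[OF _ ordLess_imp_ordLeq[OF less]])
    from iffD1[OF internalize_card_of_ordLeq this]
    obtain B :: "('a \<times> 'a) set set" where "|Field \<nu>| =o |B|"
      by (elim bexE exE conjE)
    then have B: "\<nu> =o |B|"
      by (rule ordIso_transitive[OF ordIso_symmetric[OF iso]])
    then have "?P |B|"
      by (intro allI impI ordLess_ordIso_trans[OF \<nu>(2)])
    then have "mult_upper x y \<le>o |B|"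
      unfolding mult_upper_def by (rule least(3)[OF card_of_Card_order])
    then have "mult_upper x y \<le>o \<nu>"
      by (rule ordLeq_ordIso_trans[OF _ ordIso_symmetric[OF B]])
    with not_ordLess_ordLeq[OF less] show False
      by (rule notE)
  qed
qed

lemma mult_lower_props:
  fixes x y :: "'a::lattice"
  shows "Card_order (mult_lower x y)"
    "\<exists>C. pred_on.maxchain UNIV (<) C \<and> |coverings_in C x y| =o mult_lower x y"
    "pred_on.maxchain UNIV (<) C \<Longrightarrow> mult_lower x y \<le>o |coverings_in C x y|"
proof -
  let ?P = "\<lambda>\<nu>::('a \<times> 'a) rel.
    \<exists>C. pred_on.maxchain UNIV (<) C \<and> |coverings_in C x y| =o \<nu>"
  have P: "?P |coverings_in C x y|" if "pred_on.maxchain UNIV (<) C" for C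
    using that by (auto intro: ordIso_reflexive card_of_Well_order)
  obtain C0 :: "'a set" where "pred_on.maxchain UNIV (<) C0"
    using pred_on.Hausdorff by blast
  note least = least_card_props[of _ ?P, OF card_of_Card_order P[OF this]]
  show "Card_order (mult_lower x y)"
    "\<exists>C. pred_on.maxchain UNIV (<) C \<and> |coverings_in C x y| =o mult_lower x y"
    unfolding mult_lower_def using least(1,2) by blast+
  show "mult_lower x y \<le>o |coverings_in C x y|" if "pred_on.maxchain UNIV (<) C"
    unfolding mult_lower_def using least(3)[OF card_of_Card_order P[OF that]] .
qed

text \<open>Filters of a lattice (the improper filter included), ordered by reverse inclusion.
  The library type \<open>'a filter\<close> only covers filters of the powerset of \<open>'a\<close>.\<close>

typedef (overloaded) 'a fil =
  "{F :: 'a::lattice set. F \<noteq> {} \<and> (\<forall>a\<in>F. \<forall>b. a \<le> b \<longrightarrow> b \<in> F) \<and> (\<forall>a\<in>F. \<forall>b\<in>F. inf a b \<in> F)}"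
  morphisms fil_set Abs_fil
  by (rule exI[of _ UNIV]) auto

lemma fil_set_nonempty: "fil_set F \<noteq> {}"
  and fil_set_up: "a \<in> fil_set F \<Longrightarrow> a \<le> b \<Longrightarrow> b \<in> fil_set F"
  and fil_set_inf: "a \<in> fil_set F \<Longrightarrow> b \<in> fil_set F \<Longrightarrow> inf a b \<in> fil_set F"
  using fil_set[of F] by auto

instantiation fil :: (lattice) lattice
begin

definition less_eq_fil :: "'a fil \<Rightarrow> 'a fil \<Rightarrow> bool"
  where "F \<le> G \<longleftrightarrow> fil_set G \<subseteq> fil_set F"

definition less_fil :: "'a fil \<Rightarrow> 'a fil \<Rightarrow> bool"
  where "F < G \<longleftrightarrow> fil_set G \<subset> fil_set F"

definition sup_fil :: "'a fil \<Rightarrow> 'a fil \<Rightarrow> 'a fil"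
  where "sup F G = Abs_fil (fil_set F \<inter> fil_set G)"

definition inf_fil :: "'a fil \<Rightarrow> 'a fil \<Rightarrow> 'a fil"
  where "inf F G = Abs_fil {z. \<exists>a\<in>fil_set F. \<exists>b\<in>fil_set G. inf a b \<le> z}"

lemma fil_set_sup: "fil_set (sup F G) = fil_set F \<inter> fil_set G"
proof -
  obtain a b where "a \<in> fil_set F" "b \<in> fil_set G"
    using fil_set_nonempty by blast
  then have "sup a b \<in> fil_set F \<inter> fil_set G"
    by (auto intro: fil_set_up)
  then show ?thesis
    unfolding sup_fil_def by (subst Abs_fil_inverse) (auto intro: fil_set_up fil_set_inf)
qed

lemma fil_set_inf_fil: "fil_set (inf F G) = {z. \<exists>a\<in>fil_set F. \<exists>b\<in>fil_set G. inf a b \<le> z}"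
proof -
  let ?H = "{z. \<exists>a\<in>fil_set F. \<exists>b\<in>fil_set G. inf a b \<le> z}"
  have "?H \<noteq> {}"
    using fil_set_nonempty[of F] fil_set_nonempty[of G] by blast
  moreover have "\<forall>z\<in>?H. \<forall>w. z \<le> w \<longrightarrow> w \<in> ?H"
    by (blast intro: order_trans)
  moreover have "inf z w \<in> ?H" if zw: "z \<in> ?H" "w \<in> ?H" for z w
  proof -
    obtain a b a' b' where *: "a \<in> fil_set F" "b \<in> fil_set G" "inf a b \<le> z"
        "a' \<in> fil_set F" "b' \<in> fil_set G" "inf a' b' \<le> w"
      using zw by blast
    have "inf (inf a a') (inf b b') = inf (inf a b) (inf a' b')"
      by (simp add: ac_simps)
    also have "\<dots> \<le> inf z w"
      using * by (intro inf_mono)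
    finally show ?thesis
      using * fil_set_inf by blast
  qed
  ultimately show ?thesis
    unfolding inf_fil_def by (subst Abs_fil_inverse) auto
qed

instance
proof
  fix F G H :: "'a fil"
  show "F < G \<longleftrightarrow> F \<le> G \<and> \<not> G \<le> F"
    by (auto simp: less_fil_def less_eq_fil_def)
  show "F \<le> F"
    by (simp add: less_eq_fil_def)
  show "F \<le> G \<Longrightarrow> G \<le> H \<Longrightarrow> F \<le> H"
    by (auto simp: less_eq_fil_def)
  show "F \<le> G \<Longrightarrow> G \<le> F \<Longrightarrow> F = G"
    by (auto simp: less_eq_fil_def fil_set_inject[symmetric])
  show "F \<le> sup F G" "G \<le> sup F G"
    by (auto simp: less_eq_fil_def fil_set_sup)
  show "F \<le> H \<Longrightarrow> G \<le> H \<Longrightarrow> sup F G \<le> H"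
    by (auto simp: less_eq_fil_def fil_set_sup)
  show "inf F G \<le> F"
    unfolding less_eq_fil_def fil_set_inf_fil using fil_set_nonempty[of G]
    by (auto intro: inf_le1)
  show "inf F G \<le> G"
    unfolding less_eq_fil_def fil_set_inf_fil using fil_set_nonempty[of F]
    by (auto intro: inf_le2)
  show "F \<le> G \<Longrightarrow> F \<le> H \<Longrightarrow> F \<le> inf G H"
    unfolding less_eq_fil_def fil_set_inf_fil by (blast intro: fil_set_up fil_set_inf)
qed

end

definition Fg :: "'a::lattice \<Rightarrow> 'a fil"
  where "Fg x = Abs_fil {z. x \<le> z}"

lemma fil_set_Fg: "fil_set (Fg x) = {z. x \<le> z}"
  unfolding Fg_def by (subst Abs_fil_inverse) (auto intro: order_trans)

end

theory Submission
  imports Defs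
begin

text \<open>A maximal chain \<open>C\<close> of filters is cut by a covering \<open>p \<prec> q\<close> of the lattice into the filters
  \<open>F\<close> with \<open>inf F (Fg q) \<le> Fg p\<close>, that is, those containing some \<open>f\<close> with \<open>inf f q \<le> p\<close>, and the
  filters \<open>F\<close> with \<open>Fg q \<le> sup (Fg p) F\<close>.  If this cut is a covering of \<open>C\<close>, that covering is
  projective to \<open>Fg p \<prec> Fg q\<close>.  The cut need not be a covering, because the filter
  lattice need not be meet-continuous.  But meet-continuity of the lattice allows one to
  enlarge \<open>f\<close> until it is maximal with \<open>inf f q = p\<close>.  The pair \<open>(f, sup f q)\<close>
  is projective to \<open>(p, q)\<close> and cuts \<open>C\<close> into the filters that contain \<open>f\<close> and those that do not;
  this cut is always a covering.  So if the cut of \<open>(p, q)\<close> is not a covering,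
  infinitely many coverings of this second kind lie below it.  Hence, if \<open>C\<close> has only finitely
  many coverings in the projectivity class, every \<open>p \<prec> q\<close> in the class is matched with one of
  them, and the matching is injective on the coverings of any chain.\<close>

subsection \<open>Coverings that cut each other\<close>

text \<open>The two conditions place the lower end of \<open>s\<close> in the lower part of the cut
  made by \<open>r\<close>, and the upper end in the upper part.\<close>

definition cuts_at :: "'a::lattice \<times> 'a \<Rightarrow> 'a \<times> 'a \<Rightarrow> bool"
  where "cuts_at r s \<longleftrightarrow> inf (fst s) (snd r) \<le> fst r \<and> snd r \<le> sup (fst r) (snd s)"

lemma projective_trans: "projective r s \<Longrightarrow> projective s t \<Longrightarrow> projective r t"
  unfolding projective_def by (rule tranclp_trans)

lemma projective_sym: "projective r s \<Longrightarrow> projective s r"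
  unfolding projective_def by (rule sympD[OF sym_trancl[to_pred, OF symp_on_symclp]])

lemma persp_up_projective: "r \<nearrow> s \<Longrightarrow> projective r s"
  unfolding projective_def by (auto simp: symclp_def)

lemma covers_sup_eq:
  fixes u v a :: "'a::lattice"
  assumes "u \<prec> v" "a \<le> v" "\<not> a \<le> u"
  shows "sup u a = v"
proof -
  have "u \<noteq> sup u a"
    using assms(3) by (metis sup.cobounded2)
  then have "u < sup u a" "sup u a \<le> v"
    using assms(1,2) by (auto simp: covers_def less_le)
  with assms(1) show ?thesis
    unfolding covers_def by (metis less_le)
qed

text \<open>Modularity turns the join condition into the equation, so \<open>inf v q\<close> is not
  below \<open>p\<close> and, by the meet condition, not below \<open>u\<close>. If
  \<open>inf p v\<close> were not below \<open>u\<close>, it would join with \<open>u\<close> to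
  \<open>v\<close>, and modularity would force \<open>inf v q \<le> p\<close>.\<close>

lemma cuts_at_inf:
  fixes p q u v :: "'a::modular_lattice"
  assumes "p < q" "u \<prec> v" "cuts_at (p, q) (u, v)"
  shows "sup p (inf v q) = q" "\<not> inf v q \<le> u" "inf p v \<le> u"
proof -
  from assms have low: "inf u q \<le> p" and up: "q \<le> sup p v" and pq: "p \<le> q"
    by (auto simp: cuts_at_def)
  show eq: "sup p (inf v q) = q"
    using modular[OF pq, of v] up by (simp add: inf_absorb2)
  have nle: "\<not> inf v q \<le> p"
  proof
    assume "inf v q \<le> p"
    then have "q = p"
      using eq by (simp add: sup_absorb1)
    with \<open>p < q\<close> show False by simp
  qed
  then show "\<not> inf v q \<le> u"
    using low by (meson inf.boundedI inf_le2 order_trans)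
  show "inf p v \<le> u"
  proof (rule ccontr)
    assume "\<not> inf p v \<le> u"
    then have "sup u (inf p v) = v"
      by (rule covers_sup_eq[OF \<open>u \<prec> v\<close> inf_le2])
    then have "inf v q = inf (sup (inf p v) u) q"
      by (simp add: sup_commute)
    also have "\<dots> = sup (inf p v) (inf u q)"
      by (rule modular[symmetric]) (use pq in \<open>auto intro: le_infI1\<close>)
    also have "\<dots> \<le> p"
      using low by simp
    finally show False
      using nle by simp
  qed
qed

text \<open>The common lower transpose is \<open>(inf p v, inf v q)\<close>.\<close>
lemma cuts_at_projective:
  fixes p q u v :: "'a::modular_lattice"
  assumes "p < q" "u \<prec> v" "cuts_at (p, q) (u, v)"
  shows "projective (u, v) (p, q)"
proof -
  note * = cuts_at_inf[OF assms]
  have uv: "u \<le> v" and pq: "p \<le> q" and low: "inf u q \<le> p"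
    using assms by (auto simp: covers_def cuts_at_def)
  have pv: "inf (inf v q) p = inf p v"
    using pq by (metis inf.absorb1 inf.commute inf.left_commute)
  have uq: "inf (inf v q) u = inf p v"
  proof (rule order.antisym)
    show "inf (inf v q) u \<le> inf p v"
      using low uv by (meson inf.boundedI inf_le1 inf_le2 order_trans)
    show "inf p v \<le> inf (inf v q) u"
      using *(3) pq by (meson inf.boundedI inf_le1 inf_le2 order_trans)
  qed
  have le: "inf p v \<le> inf v q"
    using pv by (metis inf_le1)
  have "(inf p v, inf v q) \<nearrow> (p, q)"
    using *(1) pv le pq by (simp add: persp_up_def sup_commute)
  moreover have "(inf p v, inf v q) \<nearrow> (u, v)"
    using covers_sup_eq[OF \<open>u \<prec> v\<close> inf_le1 *(2)] uq le uv
    by (simp add: persp_up_def sup_commute)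
  ultimately show ?thesis
    using persp_up_projective projective_sym projective_trans by blast
qed

text \<open>The first pair keeps \<open>inf v q\<close> from lying below \<open>u\<close>, the
  second puts \<open>inf p' v\<close> below \<open>u\<close>, and \<open>q \<le> p'\<close> would
  make the former the smaller one. This is what makes the matching injective.\<close>

lemma cuts_at_unique:
  fixes p q p' q' u v :: "'a::modular_lattice"
  assumes "p < q" "p' < q'" "u \<prec> v" "cuts_at (p, q) (u, v)" "cuts_at (p', q') (u, v)"
  shows "\<not> q \<le> p'"
proof
  assume "q \<le> p'"
  then have "inf v q \<le> inf p' v"
    by (auto intro: le_infI2)
  with cuts_at_inf(2)[OF assms(1,3,4)] cuts_at_inf(3)[OF assms(2,3,5)] show False
    by (meson inf.boundedI inf_le1 order_trans)
qed

section \<open>Chains and maximal chains\<close>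

lemma chain_linear:
  fixes a b :: "'a::order"
  assumes "pred_on.chain UNIV (<) C" "a \<in> C" "b \<in> C"
  shows "a \<le> b \<or> b \<le> a"
  using assms unfolding pred_on.chain_def by (auto dest: less_imp_le)

lemma chain_coverings_apart:
  fixes p q p' q' :: "'a::order"
  assumes C: "pred_on.chain UNIV (<) C" and mem: "p \<in> C" "q \<in> C" "p' \<in> C" "q' \<in> C"
    and cov: "p \<prec> q" "p' \<prec> q'"
  shows "(p, q) = (p', q') \<or> q \<le> p' \<or> q' \<le> p"
proof -
  note lin = chain_linear[OF C]
  consider "p = p'" | "p < p'" | "p' < p"
    using lin[of p p'] mem by (auto simp: less_le)
  then show ?thesis
  proof cases
    case 1
    then show ?thesis
      using lin[of q q'] mem cov by (auto simp: covers_def less_le)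
  next
    case 2
    then show ?thesis
      using lin[of q p'] mem cov by (auto simp: covers_def less_le)
  next
    case 3
    then show ?thesis
      using lin[of q' p] mem cov by (auto simp: covers_def less_le)
  qed
qed

lemma mem_maxchainI:
  fixes z :: "'a::order"
  assumes C: "pred_on.maxchain UNIV (<) C" and z: "\<And>c. c \<in> C \<Longrightarrow> c \<le> z \<or> z \<le> c"
  shows "z \<in> C"
proof (rule ccontr)
  assume "z \<notin> C"
  moreover have "pred_on.chain UNIV (<) (insert z C)"
    using C z unfolding pred_on.maxchain_def pred_on.chain_def
    by (auto simp: less_le)
  ultimately show False
    using C unfolding pred_on.maxchain_def by blast
qed

subsection \<open>The filter lattice\<close>

lemma fil_set_Abs_fil:
  fixes F :: "'a::lattice set"
  assumes "F \<noteq> {}" "\<And>a b. a \<in> F \<Longrightarrow> a \<le> b \<Longrightarrow> b \<in> F" "\<And>a b. a \<in> F \<Longrightarrow> b \<in> F \<Longrightarrow> inf a b \<in> F"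
  shows "fil_set (Abs_fil F) = F"
  using assms by (subst Abs_fil_inverse) blast+

instance fil :: (modular_lattice) modular_lattice
proof
  fix F G H :: "'a fil"
  assume FH: "F \<le> H"
  show "sup F (inf G H) = inf (sup F G) H"
  proof (rule order.antisym)
    show "sup F (inf G H) \<le> inf (sup F G) H"
      using FH by (auto intro: le_infI1)
    show "inf (sup F G) H \<le> sup F (inf G H)"
      unfolding less_eq_fil_def
    proof
      fix z assume "z \<in> fil_set (sup F (inf G H))"
      then obtain g h where z: "z \<in> fil_set F" and g: "g \<in> fil_set G" and h: "h \<in> fil_set H"
        and le: "inf g h \<le> z"
        by (auto simp: fil_set_sup fil_set_inf_fil)
      \<comment> \<open>Replacing \<open>z\<close> by \<open>inf z h\<close> stays inside
        \<open>F\<close>, since \<open>F \<le> H\<close> puts \<open>h\<close> into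
        \<open>F\<close>, and brings it below \<open>h\<close>, so that the modular law applies to
        elements.\<close>
      let ?k = "sup (inf z h) g"
      have "inf z h \<in> fil_set F"
        using FH z h by (auto simp: less_eq_fil_def intro: fil_set_inf)
      then have "?k \<in> fil_set (sup F G)"
        using g by (auto simp: fil_set_sup intro: fil_set_up)
      moreover have "inf ?k h = sup (inf z h) (inf g h)"
        by (rule modular[symmetric]) simp
      then have "inf ?k h \<le> z"
        using le by (simp add: le_infI1)
      ultimately show "z \<in> fil_set (inf (sup F G) H)"
        using h by (auto simp: fil_set_inf_fil)
    qed
  qed
qed

section \<open>Principal filters\<close>

lemma le_Fg_iff: "F \<le> Fg x \<longleftrightarrow> x \<in> fil_set F"
  by (auto simp: less_eq_fil_def fil_set_Fg intro: fil_set_up)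

lemma Fg_less_iff: "Fg x < Fg y \<longleftrightarrow> x < y"
  by (auto simp: less_le_not_le le_Fg_iff fil_set_Fg)

lemma Fg_inf: "Fg (inf x y) = inf (Fg x) (Fg y)"
proof -
  have "fil_set (Fg (inf x y)) = fil_set (inf (Fg x) (Fg y))"
    by (auto simp: fil_set_inf_fil fil_set_Fg intro: inf_mono order_trans)
  then show ?thesis
    by (simp add: fil_set_inject)
qed

lemma Fg_sup: "Fg (sup x y) = sup (Fg x) (Fg y)"
proof -
  have "fil_set (Fg (sup x y)) = fil_set (sup (Fg x) (Fg y))"
    by (auto simp: fil_set_sup fil_set_Fg)
  then show ?thesis
    by (simp add: fil_set_inject)
qed

lemma Fg_persp_up: "r \<nearrow> s \<Longrightarrow> map_prod Fg Fg r \<nearrow> map_prod Fg Fg s"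
  by (auto simp: persp_up_def le_Fg_iff fil_set_Fg Fg_inf[symmetric] Fg_sup[symmetric])

lemma Fg_projective:
  assumes "projective r s"
  shows "projective (map_prod Fg Fg r) (map_prod Fg Fg s)"
  using assms unfolding projective_def
proof (induction rule: tranclp_induct)
  case (base s)
  then have "symclp persp_up (map_prod Fg Fg r) (map_prod Fg Fg s)"
    unfolding symclp_def using Fg_persp_up by blast
  then show ?case
    by (rule tranclp.r_into_trancl)
next
  case (step s t)
  then have "symclp persp_up (map_prod Fg Fg s) (map_prod Fg Fg t)"
    unfolding symclp_def using Fg_persp_up by blast
  with step.IH show ?case
    by (rule tranclp.trancl_into_trancl)
qed

lemma inf_Fg_le_Fg_iff: "inf F (Fg q) \<le> Fg p \<longleftrightarrow> (\<exists>f\<in>fil_set F. inf f q \<le> p)"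
  by (auto simp: le_Fg_iff fil_set_inf_fil fil_set_Fg intro: order_trans[OF inf_mono])

lemma Fg_le_sup_Fg_iff: "Fg q \<le> sup (Fg p) F \<longleftrightarrow> (\<forall>f\<in>fil_set F. p \<le> f \<longrightarrow> q \<le> f)"
  by (auto simp: less_eq_fil_def fil_set_sup fil_set_Fg)

text \<open>If \<open>f\<close> in \<open>F\<close> is above \<open>p\<close>, then
  \<open>inf f q\<close> is not below \<open>p\<close>, so the covering makes \<open>q\<close> the
  join of \<open>p\<close> and \<open>inf f q\<close>, both below \<open>f\<close>. Hence the two
  parts of the cut exhaust the filters.\<close>

lemma Fg_cut_dichotomy:
  fixes p q :: "'a::lattice"
  assumes "p \<prec> q" "\<not> inf F (Fg q) \<le> Fg p"
  shows "Fg q \<le> sup (Fg p) F"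
  unfolding Fg_le_sup_Fg_iff
proof (intro ballI impI)
  fix f assume f: "f \<in> fil_set F" "p \<le> f"
  then have "\<not> inf f q \<le> p"
    using assms(2) by (auto simp: inf_Fg_le_Fg_iff)
  then have "sup p (inf f q) = q"
    using covers_sup_eq[OF assms(1) inf_le2] by blast
  with f show "q \<le> f"
    by (metis inf_le1 le_sup_iff order_refl)
qed

text \<open>An element \<open>f\<close> cuts a maximal chain of filters at the intersection of the members
  containing \<open>f\<close> and the union of the others.\<close>
lemma maxchain_fil_cut:
  fixes f :: "'a::bounded_lattice"
  assumes C: "pred_on.maxchain UNIV (<) C" and G: "G \<in> C" "f \<in> fil_set G" and f: "f \<noteq> top"
  obtains U V where "U \<in> C" "V \<in> C" "U \<prec> V" "f \<in> fil_set U" "f \<notin> fil_set V" "G \<le> U"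
proof -
  define A where "A = {F \<in> C. f \<in> fil_set F}"
  define B where "B = {F \<in> C. f \<notin> fil_set F}"
  have CAB: "F \<in> A \<or> F \<in> B" if "F \<in> C" for F
    using that by (auto simp: A_def B_def)
  have lin: "F \<le> H \<or> H \<le> F" if "F \<in> C" "H \<in> C" for F H
    using chain_linear[of C] C that unfolding pred_on.maxchain_def by blast
  have AB: "F \<le> H" if "F \<in> A" "H \<in> B" for F H
    using lin[of F H] that by (auto simp: A_def B_def less_eq_fil_def)
  define U where "U = Abs_fil (\<Inter>F\<in>A. fil_set F)"
  have U: "fil_set U = (\<Inter>F\<in>A. fil_set F)"
    unfolding U_def
  proof (rule fil_set_Abs_fil)
    show "(\<Inter>F\<in>A. fil_set F) \<noteq> {}"
      by (auto simp: A_def)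
  qed (auto intro: fil_set_up fil_set_inf)
  have fU: "f \<in> fil_set U"
    by (auto simp: U A_def)
  have AU: "F \<le> U" if "F \<in> A" for F
    using that by (auto simp: less_eq_fil_def U)
  have UB: "U \<le> F" if "F \<in> B" for F
    using AB that by (auto simp: less_eq_fil_def U)
  have UC: "U \<in> C"
    by (rule mem_maxchainI[OF C]) (use CAB AU UB in blast)
  have top_mem: "top \<in> fil_set F" for F :: "'a fil"
    using fil_set_nonempty[of F] fil_set_up[of _ F top] by auto
  \<comment> \<open>This makes \<open>B\<close> nonempty, so that the union defining
    \<open>V\<close> is a filter.\<close>
  have "Fg top \<in> C"
    by (rule mem_maxchainI[OF C]) (simp add: le_Fg_iff top_mem)
  then have topB: "Fg top \<in> B"
    using f by (auto simp: B_def fil_set_Fg top_unique)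
  define V where "V = Abs_fil (\<Union>F\<in>B. fil_set F)"
  have V: "fil_set V = (\<Union>F\<in>B. fil_set F)"
    unfolding V_def
  proof (rule fil_set_Abs_fil)
    show "(\<Union>F\<in>B. fil_set F) \<noteq> {}"
      using topB top_mem by blast
    fix a b assume "a \<in> (\<Union>F\<in>B. fil_set F)" "b \<in> (\<Union>F\<in>B. fil_set F)"
    then obtain F H where FH: "F \<in> B" "a \<in> fil_set F" "H \<in> B" "b \<in> fil_set H"
      by blast
    then have "F \<le> H \<or> H \<le> F"
      using lin by (auto simp: B_def)
    with FH show "inf a b \<in> (\<Union>F\<in>B. fil_set F)"
      by (auto simp: less_eq_fil_def intro: fil_set_inf)
  qed (auto intro: fil_set_up)
  have fV: "f \<notin> fil_set V"
    by (auto simp: V B_def)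
  have VB: "V \<le> F" if "F \<in> B" for F
    using that by (auto simp: less_eq_fil_def V)
  have AV: "F \<le> V" if "F \<in> A" for F
    using AB that by (auto simp: less_eq_fil_def V)
  have VC: "V \<in> C"
    by (rule mem_maxchainI[OF C]) (use CAB VB AV in blast)
  have UV: "U \<le> V"
    using AV UC fU by (auto simp: A_def)
  have "U \<prec> V"
    unfolding covers_def
  proof (intro conjI notI)
    show "U < V"
      using UV fU fV by (metis less_le)
    assume "\<exists>Z. U < Z \<and> Z < V"
    then obtain Z where Z: "U < Z" "Z < V"
      by blast
    \<comment> \<open>\<open>Z\<close> lies above all of \<open>A\<close> and below all of
      \<open>B\<close>, so maximality adds it to \<open>C\<close>. Membership in \<open>A\<close>
      would give \<open>Z \<le> U\<close>, membership in \<open>B\<close> would give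
      \<open>V \<le> Z\<close>.\<close>
    have "Z \<in> C"
      by (rule mem_maxchainI[OF C]) (use Z CAB AU VB in \<open>meson less_imp_le order_trans\<close>)
    with CAB AU VB Z show False
      by (meson less_le_not_le)
  qed
  with that UC VC fU fV AU G show thesis
    by (auto simp: A_def)
qed

subsection \<open>Coverings of a maximal chain of filters\<close>

text \<open>Zorn's lemma, started at \<open>sup p f0\<close>, whose meet with \<open>q\<close> is
  \<open>p\<close> by modularity. Meet-continuity preserves the meet with \<open>q\<close> at
  suprema of chains.\<close>

lemma maximal_complement:
  fixes f0 p q :: "'a::{modular_lattice, meet_continuous_lattice}"
  assumes "inf f0 q \<le> p" "p \<le> q"
  obtains f where "f0 \<le> f" "inf f q = p" "\<And>g. f < g \<Longrightarrow> inf g q \<noteq> p"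
proof -
  let ?A = "{f. sup p f0 \<le> f \<and> inf f q = p}"
  have base: "sup p f0 \<in> ?A"
    using modular[OF assms(2), of f0] assms(1) by (simp add: sup_absorb1)
  have "\<exists>f\<in>?A. \<forall>g\<in>?A. f \<le> g \<longrightarrow> g = f"
  proof (rule predicate_Zorn)
    show "partial_order_on ?A (relation_of (\<le>) ?A)"
      by (rule partial_order_on_relation_ofI) auto
    fix K assume K: "K \<in> Chains (relation_of (\<le>) ?A)"
    show "\<exists>u\<in>?A. \<forall>a\<in>K. a \<le> u"
    proof (cases "K = {}")
      case True
      then show ?thesis
        using base by blast
    next
      case False
      have KA: "a \<in> ?A" if "a \<in> K" for a
        using K that unfolding Chains_def relation_of_def by blast
      have "inf q (Sup K) = Sup ((\<lambda>d. inf q d) ` K)"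
      proof (rule meet_continuous[OF False])
        fix d e assume "d \<in> K" "e \<in> K"
        then have "d \<le> e \<or> e \<le> d"
          using K unfolding Chains_def relation_of_def by blast
        with \<open>d \<in> K\<close> \<open>e \<in> K\<close> show "\<exists>f\<in>K. d \<le> f \<and> e \<le> f"
          by blast
      qed
      also have "(\<lambda>d. inf q d) ` K = {p}"
        using KA False by (auto simp: inf_commute image_def)
      finally have "inf (Sup K) q = p"
        by (simp add: inf_commute)
      moreover have "sup p f0 \<le> Sup K"
        using False KA by (metis (mono_tags, lifting) Sup_upper2 equals0I mem_Collect_eq)
      ultimately show ?thesis
        using Sup_upper by blast
    qed
  qed
  then obtain f where f: "f \<in> ?A" "\<And>g. g \<in> ?A \<Longrightarrow> f \<le> g \<Longrightarrow> g = f"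
    by blast
  show thesis
  proof
    show "f0 \<le> f" "inf f q = p"
      using f(1) by auto
    fix g assume g: "f < g"
    then have "sup p f0 \<le> g"
      using f(1) by (auto intro: order_trans less_imp_le)
    with f(2)[of g] g show "inf g q \<noteq> p"
      by (auto dest: less_imp_le)
  qed
qed

text \<open>The covering is the one cut out by \<open>(f, sup f q)\<close>. As \<open>f\<close>
  belongs to \<open>U\<close>, \<open>U\<close> is still in the lower part for
  \<open>(p, q)\<close>; if \<open>V\<close> is too, the lemma applies again at
  \<open>V\<close>.\<close>

lemma covering_above_lower_part:
  fixes p q :: "'a::{modular_lattice, meet_continuous_lattice}"
  assumes C: "pred_on.maxchain UNIV (<) C" and G: "G \<in> C" and pq: "p \<prec> q"
    and low: "inf G (Fg q) \<le> Fg p"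
  obtains U V where "(U, V) \<in> coverings_in C (Fg p) (Fg q)" "G \<le> U" "inf U (Fg q) \<le> Fg p"
proof -
  have less: "p < q"
    using pq by (simp add: covers_def)
  obtain f0 where "f0 \<in> fil_set G" "inf f0 q \<le> p"
    using low by (auto simp: inf_Fg_le_Fg_iff)
  then obtain f where fG: "f \<in> fil_set G" and fq: "inf f q = p"
    and max: "\<And>g. f < g \<Longrightarrow> inf g q \<noteq> p"
    using maximal_complement[of f0 q p] less fil_set_up by (metis less_imp_le)
  have "f \<noteq> top"
    using fq less by auto
  then obtain U V where UV: "U \<in> C" "V \<in> C" "U \<prec> V" "f \<in> fil_set U" "f \<notin> fil_set V" "G \<le> U"
    using maxchain_fil_cut[OF C G fG] by blast
  have fsup: "f < sup f q"
    using fq less by (metis inf.absorb_iff2 less_le sup.cobounded1 sup.cobounded2)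
  \<comment> \<open>Maximality of \<open>f\<close> enters here: \<open>g\<close> differs from
    \<open>f\<close>, which is not in \<open>V\<close>, so \<open>g\<close> meets \<open>q\<close>
    outside the lower set of \<open>p\<close> and must contain \<open>q\<close>.\<close>
  have "sup f q \<le> g" if "g \<in> fil_set V" "f \<le> g" for g
  proof -
    have "f < g"
      using that UV(5) by (auto simp: less_le)
    moreover have "p \<le> g"
      using fq that(2) by (metis inf.coboundedI1)
    ultimately have "\<not> inf g q \<le> p"
      using max less by (metis inf.bounded_iff less_imp_le order.antisym)
    then have "sup p (inf g q) = q"
      using covers_sup_eq[OF pq inf_le2] by blast
    then show ?thesis
      using that(2) \<open>p \<le> g\<close> by (metis inf_le1 le_sup_iff order_refl)
  qed
  then have "cuts_at (Fg f, Fg (sup f q)) (U, V)"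
    using UV(4) by (auto simp: cuts_at_def inf_Fg_le_Fg_iff Fg_le_sup_Fg_iff
        intro!: bexI[of _ f])
  then have "projective (U, V) (Fg f, Fg (sup f q))"
    using fsup UV(3) by (intro cuts_at_projective) (simp_all add: Fg_less_iff)
  moreover have "(p, q) \<nearrow> (f, sup f q)"
    using fq less by (auto simp: persp_up_def inf_commute sup_commute)
  then have "projective (Fg p, Fg q) (Fg f, Fg (sup f q))"
    using Fg_persp_up[of "(p, q)"] persp_up_projective by fastforce
  ultimately have "projective (U, V) (Fg p, Fg q)"
    using projective_sym projective_trans by blast
  then have "(U, V) \<in> coverings_in C (Fg p) (Fg q)"
    using UV by (simp add: coverings_in_def)
  moreover have "inf U (Fg q) \<le> Fg p"
    using UV(4) fq by (auto simp: inf_Fg_le_Fg_iff)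
  ultimately show thesis
    using that UV(6) by blast
qed

lemma coverings_in_projective_cong:
  assumes "projective r s"
  shows "coverings_in C (fst r) (snd r) = coverings_in C (fst s) (snd s)"
  using assms unfolding coverings_in_def
  by (auto intro: projective_trans projective_sym)

text \<open>Take a covering in \<open>S\<close> with highest lower end \<open>W\<close>. Were its
  upper end still in the lower part of the cut, \<open>covering_above_lower_part\<close> would yield
  a higher one.\<close>

lemma finite_coverings_cut:
  fixes p q :: "'a::{modular_lattice, meet_continuous_lattice}"
  assumes C: "pred_on.maxchain UNIV (<) C" and fin: "finite (coverings_in C (Fg p) (Fg q))"
    and pq: "p \<prec> q"
  obtains U V where "(U, V) \<in> coverings_in C (Fg p) (Fg q)" "cuts_at (Fg p, Fg q) (U, V)"
proof -
  define S where "S = {(U, V) \<in> coverings_in C (Fg p) (Fg q). inf U (Fg q) \<le> Fg p}"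
  \<comment> \<open>\<open>Fg bot\<close> is the least filter, hence a starting point in the lower
    part that every maximal chain contains.\<close>
  have "Fg bot \<in> C"
    by (rule mem_maxchainI[OF C]) (simp add: less_eq_fil_def fil_set_Fg)
  moreover have "inf (Fg bot) (Fg q) \<le> Fg p"
    by (auto simp: inf_Fg_le_Fg_iff fil_set_Fg intro!: exI[of _ bot])
  ultimately have "S \<noteq> {}"
    using covering_above_lower_part[OF C _ pq] unfolding S_def by blast
  moreover have "finite S"
    using fin by (rule finite_subset[rotated]) (auto simp: S_def)
  ultimately obtain W where W: "W \<in> fst ` S" "\<And>U. U \<in> fst ` S \<Longrightarrow> W \<le> U \<Longrightarrow> W = U"
    using finite_has_maximal[of "fst ` S"] by auto
  then obtain V where WV: "(W, V) \<in> coverings_in C (Fg p) (Fg q)" "inf W (Fg q) \<le> Fg p"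
    by (auto simp: S_def)
  then have V: "V \<in> C" "W < V"
    by (auto simp: coverings_in_def covers_def)
  have "\<not> inf V (Fg q) \<le> Fg p"
  proof
    assume "inf V (Fg q) \<le> Fg p"
    then obtain U' V' where "(U', V') \<in> S" "V \<le> U'"
      using covering_above_lower_part[OF C V(1) pq] unfolding S_def by blast
    then have "U' \<in> fst ` S"
      by force
    moreover have "W < U'"
      using V(2) \<open>V \<le> U'\<close> by (rule less_le_trans)
    ultimately show False
      using W(2)[of U'] by (simp add: less_le)
  qed
  then have "cuts_at (Fg p, Fg q) (W, V)"
    using Fg_cut_dichotomy[OF pq] WV(2) by (simp add: cuts_at_def)
  with WV that show thesis
    by blast
qed

lemma coverings_in_ordLeq:
  fixes x y :: "'a::{modular_lattice, meet_continuous_lattice}"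
  assumes C: "pred_on.maxchain UNIV (<) C" and fin: "finite (coverings_in C (Fg x) (Fg y))"
    and D: "pred_on.chain UNIV (<) D"
  shows "|coverings_in D x y| \<le>o |coverings_in C (Fg x) (Fg y)|"
proof -
  have "\<exists>s\<in>coverings_in C (Fg x) (Fg y). cuts_at (map_prod Fg Fg r) s"
    if r: "r \<in> coverings_in D x y" for r
  proof -
    obtain p q where pq: "r = (p, q)" "p \<prec> q" "projective (p, q) (x, y)"
      using r by (auto simp: coverings_in_def)
    \<comment> \<open>The set depends only on the projectivity class, so the finiteness assumed for
      \<open>(x, y)\<close> carries over to \<open>(p, q)\<close>.\<close>
    have "coverings_in C (Fg p) (Fg q) = coverings_in C (Fg x) (Fg y)"
      using coverings_in_projective_cong[OF Fg_projective[OF pq(3)]] by simp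
    then show ?thesis
      using finite_coverings_cut[OF C _ pq(2)] fin pq(1) by (metis map_prod_simp)
  qed
  then obtain h where h: "\<And>r. r \<in> coverings_in D x y \<Longrightarrow>
      h r \<in> coverings_in C (Fg x) (Fg y) \<and> cuts_at (map_prod Fg Fg r) (h r)"
    by metis
  have apart: "\<not> snd r \<le> fst s"
    if r: "r \<in> coverings_in D x y" and s: "s \<in> coverings_in D x y" and eq: "h r = h s" for r s
  proof -
    obtain p q where pq: "r = (p, q)" "p < q"
      using r by (auto simp: coverings_in_def covers_def)
    obtain p' q' where pq': "s = (p', q')" "p' < q'"
      using s by (auto simp: coverings_in_def covers_def)
    obtain U V where UV: "h r = (U, V)" "U \<prec> V"
      using h[OF r] by (auto simp: coverings_in_def)
    have "\<not> Fg q \<le> Fg p'"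
      by (rule cuts_at_unique[of "Fg p" "Fg q" "Fg p'" "Fg q'" U V])
        (use h[OF r] h[OF s] pq pq' UV eq in \<open>auto simp: Fg_less_iff\<close>)
    then show ?thesis
      using pq pq' by (simp add: le_Fg_iff fil_set_Fg)
  qed
  have "inj_on h (coverings_in D x y)"
  proof (rule inj_onI)
    fix r s assume rs: "r \<in> coverings_in D x y" "s \<in> coverings_in D x y" "h r = h s"
    then have "(fst r, snd r) = (fst s, snd s) \<or> snd r \<le> fst s \<or> snd s \<le> fst r"
      by (intro chain_coverings_apart[OF D]) (auto simp: coverings_in_def)
    with apart[of r s] apart[of s r] rs show "r = s"
      by (simp add: prod_eq_iff)
  qed
  with h show ?thesis
    by (intro card_of_ordLeqI[of h]) (auto simp: inj_on_def)
qed

theorem corollary22: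
  fixes x y :: "'a::{modular_lattice, meet_continuous_lattice}"
  assumes "x \<prec> y"
    and "cinfinite (mult_upper x y)"
  shows "cinfinite (mult_lower (Fg x) (Fg y))"
proof (rule ccontr)
  assume "\<not> cinfinite (mult_lower (Fg x) (Fg y))"
  then have fin: "finite (Field (mult_lower (Fg x) (Fg y)))"
    by (simp add: cinfinite_def)
  obtain C where C: "pred_on.maxchain UNIV (<) C"
    and iso: "|coverings_in C (Fg x) (Fg y)| =o mult_lower (Fg x) (Fg y)"
    using mult_lower_props(2) by blast
  let ?S = "coverings_in C (Fg x) (Fg y)"
  have finS: "finite ?S"
    using card_of_ordIso_finite_Field[OF mult_lower_props(1) ordIso_symmetric[OF iso]] fin by simp
  \<comment> \<open>The upper bound must strictly exceed every multiplicity; the power set is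
    strictly larger than \<open>?S\<close> and still finite.\<close>
  have "mult_upper x y \<le>o |Pow ?S|"
  proof (rule mult_upper_props(3))
    show "Card_order |Pow ?S|"
      by (rule card_of_Card_order)
    show "|coverings_in D x y| <o |Pow ?S|" if "pred_on.chain UNIV (<) D" for D
      by (rule ordLeq_ordLess_trans[OF coverings_in_ordLeq[OF C finS that] card_of_Pow])
  qed
  then have "finite (Field (mult_upper x y))"
    using finS card_of_ordLeq_finite[of "Field (mult_upper x y)" "Pow ?S"]
    by (metis Field_card_of card_of_mono2 finite_Pow_iff)
  with assms(2) show False
    by (simp add: cinfinite_def)
qed

end
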